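(* Let $k\ge 1$ be an integer, $z\ge 1$ a constant and $\varepsilon\in(0,1)$ a real number. For every positive integer $d\le\frac{1}{100\varepsilon^2}$, there is a finite dataset $P\subset\mathbb{R}^{d+1}$ such that every $\varepsilon$-coreset of $P$ for Euclidean $(k,z)$-Clustering contains at least $\frac{dk}{10z^4}$ points.
   Context: For a finite $P\subset\mathbb{R}^{D}$ and a set $C\subset\mathbb{R}^{D}$ of $k$ centers, $\mathrm{cost}_z(P,C)=\sum_{p\in P}\min_{c\in C}\|p-c\|_2^z$. An $\varepsilon$-coreset of $P$ for Euclidean $(k,z)$-Clustering is a subset $S\subseteq P$ with a weight function $w:S\to\mathbb{R}_{\ge 0}$ such that for every $C\subset\mathbb{R}^{D}$ with $|C|=k$, $$(1-\varepsilon)\,\mathrm{cost}_z(P,C)\le\sum_{p\in S}w(p)\min_{c\in C}\|p-c\|_2^z\le(1+\varepsilon)\,\mathrm{cost}_z(P,C).$$ Here $D=d+1$. *)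

theory Defs
  imports "HOL-Analysis.Analysis"
begin

text \<open>
  The exponent \<open>z\<close> is real, hence \<open>powr\<close>; since \<open>0 powr z = 0\<close>, a point
  coinciding with a center contributes cost \<open>0\<close>. The term \<open>Min\<close> is only meaningful for a
  finite nonempty set of centers.
\<close>

definition point_cost :: "real \<Rightarrow> 'a::euclidean_space \<Rightarrow> 'a set \<Rightarrow> real" where
  "point_cost z p C = Min ((\<lambda>c. norm (p - c) powr z) ` C)"

definition cost :: "real \<Rightarrow> 'a::euclidean_space set \<Rightarrow> 'a set \<Rightarrow> real" where
  "cost z P C = (\<Sum>p\<in>P. point_cost z p C)"

text \<open>
  The weight function is total here, but only its values on \<open>S\<close> matter.
\<close>

definition is_coreset ::
  "real \<Rightarrow> nat \<Rightarrow> real \<Rightarrow> 'a::euclidean_space set \<Rightarrow> 'a set \<Rightarrow> ('a \<Rightarrow> real) \<Rightarrow> bool" where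
  "is_coreset \<epsilon> k z P S w \<longleftrightarrow>
     S \<subseteq> P \<and> (\<forall>p\<in>S. 0 \<le> w p) \<and>
     (\<forall>C. finite C \<and> card C = k \<longrightarrow>
        (1 - \<epsilon>) * cost z P C \<le> (\<Sum>p\<in>S. w p * point_cost z p C) \<and>
        (\<Sum>p\<in>S. w p * point_cost z p C) \<le> (1 + \<epsilon>) * cost z P C)"

end

theory Submission imports Defs begin

text \<open>
  Place \<open>k\<close> copies of the \<open>d\<close> standard basis vectors far apart along the remaining axis \<open>e\<close>; a
  center set with one center near each copy serves every copy by its own center. Suppose the coreset
  \<open>S\<close> is small. Then more than three quarters of the copies are light: they contain at most
  \<open>2 d / 5\<close> points of \<open>S\<close>. Three center sets, all placed relative to the copies, are compared.
  Centers at \<open>sqrt (1 / 2) e\<close> everywhere bound the total weight from above. Moving the centers of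
  the light copies further out along \<open>e\<close> bounds the weight of the light copies from below. Finally,
  tilting the center of each light copy towards exactly those points of the copy that lie in \<open>S\<close>,
  by \<open>1 / sqrt d\<close> in each such coordinate while keeping its norm, lowers the cost of all of \<open>S\<close> there
  by a fraction of order \<open>1 / sqrt d\<close>, but leaves most points of \<open>P\<close> unaffected. This discrepancy
  exceeds what an error of \<open>\<epsilon> \<le> 1 / (10 sqrt d)\<close> allows.
\<close>

section \<open>Separated copies and their nearest centers\<close>

lemma point_cost_eqI:
  assumes "finite C" "c \<in> C" "z \<ge> 0" "\<And>c'. c' \<in> C \<Longrightarrow> norm (p - c) \<le> norm (p - c')"
  shows "point_cost z p C = norm (p - c) powr z"
  unfolding point_cost_def
  using assms by (intro Min_eqI) (auto intro!: powr_mono2)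

text \<open>Here \<open>n\<close> is the index of the extra axis, and only indices \<open>b\<close>
  other than \<open>n\<close> yield data points. The spacing 100 dominates every distance that
  occurs within one copy.\<close>

definition copies :: "'n \<Rightarrow> nat \<Rightarrow> 'n \<Rightarrow> real ^ 'n::finite" where
  "copies n j b = axis b 1 + (100 * real j) *\<^sub>R axis n 1"

text \<open>The vector \<open>u j\<close> is the center of copy \<open>j\<close> in coordinates
  relative to that copy.\<close>

definition shifted :: "'n \<Rightarrow> nat \<Rightarrow> (nat \<Rightarrow> real ^ 'n) \<Rightarrow> (real ^ 'n::finite) set" where
  "shifted n k u = (\<lambda>j. u j + (100 * real j) *\<^sub>R axis n 1) ` {..<k}"

text \<open>Two copies are at least 100 apart, and \<open>v\<close> can undo at most 10 of this. It
  is applied to differences of two centers and of a point and a foreign center.\<close>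

lemma norm_shift_ge:
  fixes v :: "real ^ 'n::finite"
  assumes "i \<noteq> j" "norm v \<le> 10"
  shows "norm (v + (100 * real i) *\<^sub>R axis n 1 - (100 * real j) *\<^sub>R axis n 1) \<ge> 90"
proof -
  define w where "w = (100 * real i - 100 * real j) *\<^sub>R (axis n 1 :: real ^ 'n)"
  have "\<bar>real i - real j\<bar> \<ge> 1" using assms(1) by linarith
  then have "100 \<le> 100 * \<bar>real i - real j\<bar>" by simp
  also have "\<dots> = norm w"
    by (simp add: w_def norm_axis_1 abs_if)
  finally have "norm (w + v) \<ge> 90"
    using assms(2) norm_diff_ineq[of w v] by linarith
  then show ?thesis
    by (simp add: w_def scaleR_left_diff_distrib algebra_simps)
qed

text \<open>A coreset is tested on sets of exactly \<open>k\<close> centers, so no two translated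
  centers may coincide.\<close>

lemma card_shifted:
  fixes u :: "nat \<Rightarrow> real ^ 'n::finite"
  assumes "\<And>j. norm (u j) \<le> 5"
  shows "card (shifted n k u) = k"
proof -
  have "inj (\<lambda>j. u j + (100 * real j) *\<^sub>R axis n 1)"
  proof (rule injI, rule ccontr)
    fix i j assume eq: "u i + (100 * real i) *\<^sub>R axis n 1 = u j + (100 * real j) *\<^sub>R axis n 1"
      and "i \<noteq> j"
    have "norm (u i - u j) \<le> 10"
      using norm_triangle_ineq4[of "u i" "u j"] assms[of i] assms[of j] by linarith
    from norm_shift_ge[OF \<open>i \<noteq> j\<close> this, of n] eq show False
      by (simp add: algebra_simps)
  qed
  then show ?thesis
    unfolding shifted_def by (subst card_image) (auto intro: inj_on_subset)
qed

lemma finite_shifted [simp]: "finite (shifted n k u)"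
  by (simp add: shifted_def)

text \<open>Coordinate \<open>n\<close> of a point reveals its copy, because the basis vectors with
  \<open>b\<close> other than \<open>n\<close> vanish there.\<close>

lemma inj_on_copies:
  "inj_on (case_prod (copies n)) (UNIV \<times> (- {n}))"
proof -
  have "i = j \<and> b = c" if "b \<noteq> n" "c \<noteq> n" and eq: "copies n i b = copies n j c" for i j b c
  proof -
    have "copies n i b $ n = 100 * real i" "copies n j c $ n = 100 * real j"
      using that(1,2) by (simp_all add: copies_def axis_def)
    with eq have "i = j" by simp
    with eq show ?thesis by (simp add: copies_def axis_eq_axis)
  qed
  then show ?thesis by (auto simp: inj_on_def)
qed

text \<open>The center of the point's own copy is within distance 6, any other center is at distance
  at least 90. Costs therefore decouple into separate contributions of the copies.\<close>

lemma point_cost_shifted: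
  fixes u :: "nat \<Rightarrow> real ^ 'n::finite"
  assumes u: "\<And>j. norm (u j) \<le> 5" and "i < k" "z \<ge> 0"
  shows "point_cost z (copies n i b) (shifted n k u) = norm (axis b 1 - u i) powr z"
proof -
  let ?c = "\<lambda>j. u j + (100 * real j) *\<^sub>R axis n 1"
  have small: "norm (axis b 1 - u j) \<le> 6" for j
    using norm_triangle_ineq4[of "axis b 1" "u j"] u[of j] by (simp add: norm_axis_1)
  have own: "copies n i b - ?c i = axis b 1 - u i"
    by (simp add: copies_def)
  have "point_cost z (copies n i b) (shifted n k u) = norm (copies n i b - ?c i) powr z"
  proof (rule point_cost_eqI)
    fix c' assume "c' \<in> shifted n k u"
    then obtain j where c': "c' = ?c j" by (auto simp: shifted_def)
    show "norm (copies n i b - ?c i) \<le> norm (copies n i b - c')"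
    proof (cases "j = i")
      case False
      with norm_shift_ge[of i j "axis b 1 - u j" n] small[of j] small[of i]
      show ?thesis unfolding own by (simp add: c' copies_def algebra_simps)
    qed (simp add: c')
  qed (use assms in \<open>auto simp: shifted_def\<close>)
  then show ?thesis unfolding own .
qed

section \<open>Distances from basis vectors to plain and tilted centers\<close>

text \<open>Expand the squared norm. At fixed norm of the center, the cost of a basis vector depends
  on a single coordinate, so a tilt changes the cost only in the tilted coordinates.\<close>

lemma norm_axis_diff_powr:
  fixes u :: "real ^ 'n::finite"
  shows "norm (axis b 1 - u) powr z = (1 + (norm u)\<^sup>2 - 2 * u $ b) powr (z / 2)"
proof -
  have "(norm (axis b 1 - u))\<^sup>2 = 1 + (norm u)\<^sup>2 - 2 * u $ b"
    by (simp add: power2_norm_eq_inner inner_diff_left inner_diff_right inner_axis inner_axis_axis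
        inner_commute[of _ "axis b 1"] inner_axis')
  moreover have "norm (axis b 1 - u) powr z = ((norm (axis b 1 - u))\<^sup>2) powr (z / 2)"
    by (simp add: powr_powr flip: powr_numeral)
  ultimately show ?thesis by simp
qed

lemma norm_axis_multiple: "(norm (c *\<^sub>R axis n 1 :: real ^ 'n::finite))\<^sup>2 = c\<^sup>2"
  by (simp add: norm_axis_1)

text \<open>The entry at \<open>n\<close> compensates for the tilt and keeps the squared norm at
  1/2.\<close>

definition tilted :: "'n \<Rightarrow> real \<Rightarrow> 'n set \<Rightarrow> real ^ 'n::finite" where
  "tilted n t A = (\<chi> b. if b = n then sqrt (1/2 - real (card A) * t\<^sup>2) else if b \<in> A then t else 0)"

lemma norm_tilted:
  assumes "n \<notin> A" "real (card A) * t\<^sup>2 \<le> 1/2"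
  shows "(norm (tilted n t A))\<^sup>2 = 1/2"
proof -
  have "(norm (tilted n t A))\<^sup>2 = (\<Sum>b\<in>UNIV. (tilted n t A $ b)\<^sup>2)"
    by (simp add: norm_vec_def L2_set_def sum_nonneg)
  also have "\<dots> = (tilted n t A $ n)\<^sup>2 + (\<Sum>b\<in>UNIV - {n}. (tilted n t A $ b)\<^sup>2)"
    by (subst sum.remove[of _ n]) auto
  also have "(\<Sum>b\<in>UNIV - {n}. (tilted n t A $ b)\<^sup>2) = (\<Sum>b\<in>A. t\<^sup>2)"
    using assms(1) by (intro sum.mono_neutral_cong_right) (auto simp: tilted_def)
  finally show ?thesis
    using assms(2) by (simp add: tilted_def)
qed

section \<open>Numerical estimates\<close>

text \<open>The three comparisons in units of the base cost of a point. \<open>T\<close> and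
  \<open>H\<close> count light and heavy copies, \<open>W\<close> and \<open>V\<close> are their
  coreset weights, \<open>r\<close> is the cost factor of the far centers and \<open>x\<close> the
  fraction of cost saved by the tilt.\<close>

lemma light_copies_contradiction:
  fixes \<epsilon> r x d T H W V :: real
  assumes \<epsilon>: "0 < \<epsilon>" "\<epsilon> \<le> 1/10" and "d > 0" and HT: "0 \<le> H" "3 * H < T"
    and r: "r \<ge> 4" and x: "x \<ge> 20/3 * \<epsilon>"
    and total: "W + V \<le> (1 + \<epsilon>) * ((T + H) * d)"
    and far: "(1 - \<epsilon>) * (r * (T * d) + H * d) \<le> r * W + V"
    and tilt: "(1 - \<epsilon>) * (T * d - x * (2/5 * (T * d)) + H * d) \<le> (1 - x) * W + V"
  shows False
proof -
  define D where "D = T * d"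
  define E where "E = H * d"
  have E: "0 \<le> E" "3 * E < D"
    using HT \<open>d > 0\<close> by (simp_all add: D_def E_def)
  \<comment> \<open>Subtracting \<open>total\<close> from \<open>far\<close> eliminates the weight
    \<open>V\<close>.\<close>
  have "(r - 1) * W \<ge> (r - 1) * D - \<epsilon> * ((r + 1) * D + 2 * E)"
    using total far by (simp add: D_def E_def algebra_simps)
  moreover have "(r + 1) * D + 2 * E \<le> 2 * (r - 1) * D"
  proof -
    have "4 * D \<le> r * D" using r E by (intro mult_right_mono) auto
    moreover have "2 * (r - 1) * D - (r + 1) * D = r * D - 3 * D" by (simp add: algebra_simps)
    ultimately show ?thesis using E by linarith
  qed
  then have "\<epsilon> * ((r + 1) * D + 2 * E) \<le> \<epsilon> * (2 * (r - 1) * D)"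
    using \<epsilon> by (intro mult_left_mono) auto
  ultimately have "(r - 1) * W \<ge> (r - 1) * (D - 2 * \<epsilon> * D)"
    by (simp add: algebra_simps)
  then have "W \<ge> D - 2 * \<epsilon> * D" using r by simp
  moreover have "\<epsilon> * D \<le> 1/10 * D" using \<epsilon> E by (intro mult_right_mono) auto
  ultimately have W: "W \<ge> 4/5 * D" by linarith
  \<comment> \<open>Subtracting \<open>tilt\<close> from \<open>total\<close> eliminates
    \<open>V\<close> again.\<close>
  have "x * W \<le> 2 * \<epsilon> * (D + E) + (1 - \<epsilon>) * (x * (2/5 * D))"
    using total tilt by (simp add: D_def E_def algebra_simps)
  also have "(1 - \<epsilon>) * (x * (2/5 * D)) \<le> 1 * (x * (2/5 * D))"
    using \<epsilon> x E by (intro mult_right_mono) auto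
  finally have "x * (W - 2/5 * D) \<le> 2 * \<epsilon> * (D + E)" by (simp add: algebra_simps)
  \<comment> \<open>Since \<open>W\<close> is at least \<open>4/5 * D\<close>, the left factor
    \<open>2/5 * D\<close> is available. This gives \<open>8/3 * \<epsilon> * D\<close>, whereas
    \<open>2 * \<epsilon> * (D + E)\<close> is strictly smaller because
    \<open>3 * E < D\<close>.\<close>
  moreover have "20/3 * \<epsilon> * (2/5 * D) \<le> x * (W - 2/5 * D)"
    using \<epsilon> x E W by (intro mult_mono) auto
  moreover have "\<epsilon> * (3 * E) < \<epsilon> * D" using \<epsilon> E by simp
  ultimately show False by (simp add: algebra_simps)
qed

text \<open>The bound on \<open>d\<close> says that \<open>\<epsilon>\<close> is at most
  \<open>1 / (10 * sqrt d)\<close>, so \<open>20/3 * \<epsilon>\<close> is at most half of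
  \<open>4 / (3 * sqrt d)\<close>. That half is saved already at \<open>z = 1\<close>, and on a base
  in [0,1] larger exponents save at least as much. The truncation at 0 matters for
  \<open>d = 1\<close>, where the base would be negative.\<close>

lemma tilt_gain:
  fixes d \<epsilon> z :: real
  assumes "d \<ge> 1" "0 < \<epsilon>" "d \<le> 1 / (100 * \<epsilon>\<^sup>2)" "z \<ge> 1"
  shows "1 - (max 0 (1 - 4 / (3 * sqrt d))) powr (z / 2) \<ge> 20/3 * \<epsilon>"
proof -
  define y where "y = 4 / (3 * sqrt d)"
  define b where "b = max 0 (1 - y)"
  have s: "sqrt d \<ge> 1" using assms by simp
  have y: "0 < y" "y \<le> 4/3" using s by (auto simp: y_def field_simps)
  have "(10 * \<epsilon> * sqrt d)\<^sup>2 \<le> 1\<^sup>2"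
    using assms by (simp add: power_mult_distrib field_simps)
  then have "10 * \<epsilon> * sqrt d \<le> 1"
    by (rule power2_le_imp_le) simp
  then have "20/3 * \<epsilon> \<le> y / 2" using s by (simp add: y_def field_simps)
  moreover have "b powr (z / 2) \<le> 1 - y / 2"
  proof -
    have b: "0 \<le> b" "b \<le> 1" using y by (auto simp: b_def)
    have "b powr (z / 2) \<le> sqrt b"
    proof (cases "b = 0")
      case False
      then show ?thesis using b assms
        by (simp add: powr_mono' flip: powr_half_sqrt)
    qed simp
    also have "\<dots> \<le> 1 - y / 2"
    proof (rule real_le_lsqrt)
      have "(1 - y / 2)\<^sup>2 = 1 - y + (y/2)\<^sup>2" by (simp add: power2_eq_square algebra_simps)
      then have "1 - y \<le> (1 - y / 2)\<^sup>2" by simp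
      then show "b \<le> (1 - y / 2)\<^sup>2"
        unfolding b_def by (intro max.boundedI zero_le_power2)
    qed (use y b in auto)
    finally show ?thesis .
  qed
  ultimately show ?thesis by (simp add: b_def y_def)
qed

section \<open>The dataset and sums over its subsets\<close>

definition copy_data :: "'n \<Rightarrow> nat \<Rightarrow> (real ^ 'n::finite) set" where
  "copy_data n k = case_prod (copies n) ` ({..<k} \<times> (- {n}))"

lemma finite_copy_data [simp]: "finite (copy_data n k)"
  by (simp add: copy_data_def)

lemma copies_mem_copy_data: "j < k \<Longrightarrow> b \<noteq> n \<Longrightarrow> copies n j b \<in> copy_data n k"
  unfolding copy_data_def by (rule image_eqI[of _ _ "(j, b)"]) simp_all

text \<open>Used with \<open>S\<close> the whole dataset for the cost, with a coreset for its
  weighted cost, and with constant \<open>f\<close> for counting.\<close>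

lemma sum_subset_copy_data:
  assumes "S \<subseteq> copy_data n k"
  shows "(\<Sum>p\<in>S. f p) = (\<Sum>j<k. \<Sum>b | b \<noteq> n \<and> copies n j b \<in> S. f (copies n j b))"
proof -
  define I where "I = (SIGMA j:{..<k}. {b. b \<noteq> n \<and> copies n j b \<in> S})"
  have "I \<subseteq> UNIV \<times> (- {n})" by (auto simp: I_def)
  then have "inj_on (case_prod (copies n)) I"
    using inj_on_copies inj_on_subset by blast
  moreover have "S = case_prod (copies n) ` I"
    using assms by (force simp: I_def copy_data_def)
  ultimately have "sum f S = sum (f \<circ> case_prod (copies n)) I"
    by (metis sum.reindex)
  also have "\<dots> = (\<Sum>j<k. \<Sum>b | b \<noteq> n \<and> copies n j b \<in> S. f (copies n j b))"
    unfolding I_def by (subst sum.Sigma) (auto intro!: sum.cong)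
  finally show ?thesis .
qed

section \<open>The lower bound on the size of a coreset\<close>

theorem theorem3p8:
  fixes k d :: nat and z \<epsilon> :: real
  assumes "k \<ge> 1" and "z \<ge> 1" and "0 < \<epsilon>" and "\<epsilon> < 1"
    and "d \<ge> 1" and "real d \<le> 1 / (100 * \<epsilon>\<^sup>2)"
    and "CARD('n::finite) = d + 1"
  shows "\<exists>P :: (real ^ 'n) set. finite P \<and>
    (\<forall>S w. is_coreset \<epsilon> k z P S w \<longrightarrow> real (card S) \<ge> real d * real k / (10 * z ^ 4))"
proof -
  obtain n :: 'n where True by simp
  have "real (card S) \<ge> real d * real k / (10 * z ^ 4)"
    if core: "is_coreset \<epsilon> k z (copy_data n k) S w" for S w
  proof (rule ccontr)
    assume small: "\<not> ?thesis"
    have SP: "S \<subseteq> copy_data n k"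
      using core by (simp add: is_coreset_def)
    define A where "A j = {b. b \<noteq> n \<and> copies n j b \<in> S}" for j
    define L where "L = {j\<in>{..<k}. real (card (A j)) \<le> 2/5 * real d}"
    define G where "G = {..<k} - L"
    define h where "h = sqrt (1/2) *\<^sub>R (axis n 1 :: real ^ 'n)"
    \<comment> \<open>\<open>\<beta>\<close> is the cost of a data point whose center is
      \<open>h\<close>, at squared distance 1 + 1/2. The factors \<open>r\<close> and
      \<open>a\<close> turn it into the cost for a far center and for a center tilted towards the
      point.\<close>
    define \<beta> where "\<beta> = (3/2 :: real) powr (z / 2)"
    define r where "r = 16 powr (z / 2)"
    define a where "a = (max 0 (1 - 4 / (3 * sqrt (real d)))) powr (z / 2)"
    define om where "om J = (\<Sum>j\<in>J. \<Sum>b\<in>A j. w (copies n j b))" for J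
    have LG: "L \<inter> G = {}" "L \<union> G = {..<k}" "finite L" "finite G"
      by (auto simp: L_def G_def)
    have split: "(\<Sum>j<k. f j) = (\<Sum>j\<in>L. f j) + (\<Sum>j\<in>G. f j)" for f :: "nat \<Rightarrow> real"
      using LG by (metis sum.union_disjoint)
    have nA: "n \<notin> A j" "finite (A j)" for j by (auto simp: A_def)
    have cardB: "card (- {n}) = d" using assms(7) by (simp add: Compl_eq_Diff_UNIV)
    have \<beta>: "\<beta> > 0" by (simp add: \<beta>_def)

    \<comment> \<open>Both coreset inequalities for arbitrary relative centers of norm at most 5,
      written as sums over copies.\<close>
    have cost_le: "(1 - \<epsilon>) * (\<Sum>j<k. \<Sum>b\<in>-{n}. norm (axis b 1 - u j) powr z)
          \<le> (\<Sum>j<k. \<Sum>b\<in>A j. w (copies n j b) * norm (axis b 1 - u j) powr z)"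
      and cost_ge: "(\<Sum>j<k. \<Sum>b\<in>A j. w (copies n j b) * norm (axis b 1 - u j) powr z)
          \<le> (1 + \<epsilon>) * (\<Sum>j<k. \<Sum>b\<in>-{n}. norm (axis b 1 - u j) powr z)"
      if u: "\<And>j. norm (u j) \<le> 5" for u :: "nat \<Rightarrow> real ^ 'n"
    proof -
      have z: "z \<ge> 0" using assms by simp
      note pc = point_cost_shifted[OF u _ z, of _ k n]
      have "(\<Sum>p\<in>S. w p * point_cost z p (shifted n k u))
          = (\<Sum>j<k. \<Sum>b\<in>A j. w (copies n j b) * norm (axis b 1 - u j) powr z)"
        unfolding sum_subset_copy_data[OF SP] A_def using pc by simp
      moreover have "cost z (copy_data n k) (shifted n k u)
          = (\<Sum>j<k. \<Sum>b\<in>-{n}. norm (axis b 1 - u j) powr z)"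
        unfolding cost_def sum_subset_copy_data[OF subset_refl]
        by (intro sum.cong) (auto simp: pc copies_mem_copy_data)
      moreover have "(1 - \<epsilon>) * cost z (copy_data n k) (shifted n k u)
            \<le> (\<Sum>p\<in>S. w p * point_cost z p (shifted n k u)) \<and>
          (\<Sum>p\<in>S. w p * point_cost z p (shifted n k u))
            \<le> (1 + \<epsilon>) * cost z (copy_data n k) (shifted n k u)"
        using core card_shifted[OF u, of n k] finite_shifted[of n k u]
        unfolding is_coreset_def by presburger
      ultimately show "(1 - \<epsilon>) * (\<Sum>j<k. \<Sum>b\<in>-{n}. norm (axis b 1 - u j) powr z)
          \<le> (\<Sum>j<k. \<Sum>b\<in>A j. w (copies n j b) * norm (axis b 1 - u j) powr z)"
        and "(\<Sum>j<k. \<Sum>b\<in>A j. w (copies n j b) * norm (axis b 1 - u j) powr z)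
          \<le> (1 + \<epsilon>) * (\<Sum>j<k. \<Sum>b\<in>-{n}. norm (axis b 1 - u j) powr z)"
        by simp_all
    qed

    have cancel_left: "c * X \<le> Y" if "c * (\<beta> * X) \<le> \<beta> * Y" for c X Y
      using that \<beta> by (simp add: mult.left_commute)
    have cancel_right: "X \<le> c * Y" if "\<beta> * X \<le> c * (\<beta> * Y)" for c X Y
      using that \<beta> by (simp add: mult.left_commute)
    have norm_le: "norm u \<le> 5" if "(norm u)\<^sup>2 \<le> 25" for u :: "real ^ 'n"
      using that by (auto intro: power2_le_imp_le[of _ 5])
    have h2: "(norm h)\<^sup>2 = 1/2"
      unfolding h_def norm_axis_multiple by simp
    then have h: "norm h \<le> 5" by (simp add: norm_le)
    have h_cost: "norm (axis b 1 - h) powr z = \<beta>" if "b \<noteq> n" for b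
      using that by (simp add: norm_axis_diff_powr h2) (simp add: h_def axis_def \<beta>_def)
    have ne: "b \<noteq> n" if "b \<in> A j" for b j using that nA by blast
    have inner: "A j \<subseteq> -{n}" for j by (auto simp: A_def)

    have total: "om L + om G \<le> (1 + \<epsilon>) * ((real (card L) + real (card G)) * real d)"
    proof -
      have k: "real (card L) + real (card G) = real k"
        using LG by (metis card_Un_disjoint card_lessThan of_nat_add)
      have "(\<Sum>j<k. \<Sum>b\<in>A j. w (copies n j b) * norm (axis b 1 - h) powr z)
          = \<beta> * (om L + om G)"
        unfolding split om_def distrib_left sum_distrib_left
        by (intro arg_cong2[of _ _ _ _ "(+)"] sum.cong refl) (simp_all add: ne h_cost)
      moreover have "(\<Sum>j<k. \<Sum>b\<in>-{n}. norm (axis b 1 - h) powr z) = \<beta> * (real k * real d)"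
        using cardB by (simp add: h_cost)
      moreover note cost_ge[of "\<lambda>_. h", OF h]
      ultimately have "\<beta> * (om L + om G) \<le> (1 + \<epsilon>) * (\<beta> * (real k * real d))"
        by (simp only:)
      then show ?thesis unfolding k by (rule cancel_right)
    qed

    have far: "(1 - \<epsilon>) * (r * (real (card L) * real d) + real (card G) * real d) \<le> r * om L + om G"
    proof -
      \<comment> \<open>The squared distance becomes 1 + 23 = 16 * 3/2, and the norm of
        \<open>f\<close> stays below 5.\<close>
      define f where "f = sqrt 23 *\<^sub>R (axis n 1 :: real ^ 'n)"
      have f2: "(norm f)\<^sup>2 = 23"
        unfolding f_def norm_axis_multiple by simp
      then have f: "norm f \<le> 5" by (simp add: norm_le)
      have \<beta>r: "\<beta> * r = 24 powr (z / 2)"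
        unfolding \<beta>_def r_def by (subst powr_mult[symmetric]) simp_all
      have f_cost: "norm (axis b 1 - f) powr z = \<beta> * r" if "b \<noteq> n" for b
        using that
        by (simp add: norm_axis_diff_powr f2) (simp add: f_def axis_def \<beta>r)
      define u where "u j = (if j \<in> L then f else h)" for j
      have u: "j \<in> L \<Longrightarrow> u j = f" "j \<in> G \<Longrightarrow> u j = h" for j
        using LG by (auto simp: u_def)
      have "(\<Sum>j<k. \<Sum>b\<in>A j. w (copies n j b) * norm (axis b 1 - u j) powr z)
          = \<beta> * (r * om L + om G)"
        unfolding split om_def distrib_left sum_distrib_left
        by (intro arg_cong2[of _ _ _ _ "(+)"] sum.cong refl) (simp_all add: ne u h_cost f_cost)
      moreover have "(\<Sum>j<k. \<Sum>b\<in>-{n}. norm (axis b 1 - u j) powr z)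
          = \<beta> * (r * (real (card L) * real d) + real (card G) * real d)"
        unfolding split using cardB by (simp add: u h_cost f_cost algebra_simps)
      moreover have "norm (u j) \<le> 5" for j using h f by (simp add: u_def)
      note cost_le[of u, OF this]
      ultimately have "(1 - \<epsilon>) * (\<beta> * (r * (real (card L) * real d) + real (card G) * real d))
          \<le> \<beta> * (r * om L + om G)"
        by (simp only:)
      then show ?thesis by (rule cancel_left)
    qed

    have x: "1 - a \<ge> 20/3 * \<epsilon>"
      unfolding a_def using assms by (intro tilt_gain) auto

    have tilt: "(1 - \<epsilon>) * (real (card L) * real d - (1 - a) * (2/5 * (real (card L) * real d))
        + real (card G) * real d) \<le> (1 - (1 - a)) * om L + om G"
    proof -
      define t where "t = 1 / sqrt (real d)"
      have t2: "t\<^sup>2 = 1 / real d" by (simp add: t_def power_divide)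
      define u where "u j = (if j \<in> L then tilted n t (A j) else h)" for j
      \<comment> \<open>In a light copy the tilt uses at most 2/5 of the squared norm 1/2, so the
        square root in \<open>tilted\<close> has a nonnegative argument.\<close>
      have v: "(norm (tilted n t (A j)))\<^sup>2 = 1/2" if "j \<in> L" for j
        using that nA assms by (intro norm_tilted) (auto simp: L_def t2 field_simps)
      have u5: "norm (u j) \<le> 5" for j
        using norm_le[of "tilted n t (A j)"] v[of j] h by (cases "j \<in> L") (simp_all add: u_def)
      have u: "j \<in> G \<Longrightarrow> u j = h" for j
        using LG by (auto simp: u_def)
      have dist: "norm (axis b 1 - u j) powr z = (3/2 - 2 * tilted n t (A j) $ b) powr (z / 2)"
        if "j \<in> L" for b j
        using that by (simp add: u_def norm_axis_diff_powr v)
      have out: "norm (axis b 1 - u j) powr z = \<beta>" if "j \<in> L" "b \<notin> A j" "b \<noteq> n" for b j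
        using that by (simp add: dist tilted_def \<beta>_def)
      have inA: "norm (axis b 1 - u j) powr z = \<beta> * a" if "j \<in> L" "b \<in> A j" for b j
      proof -
        \<comment> \<open>A light copy that meets \<open>S\<close> forces
          \<open>1 \<le> 2/5 * d\<close>. Then \<open>d\<close> is at least 16/9 and the truncation
          in \<open>a\<close> is inactive.\<close>
        have "card (A j) \<ge> 1" using that nA by (auto simp: Suc_le_eq card_gt_0_iff)
        then have "real d \<ge> (4/3)\<^sup>2"
          using that by (simp add: L_def power2_eq_square)
        then have "sqrt (real d) \<ge> 4/3" by (rule real_le_rsqrt)
        then have "4 / (3 * sqrt (real d)) \<le> 1" by (subst pos_divide_le_eq) linarith+
        then have "max 0 (1 - 4 / (3 * sqrt (real d))) = 1 - 4 / (3 * sqrt (real d))" by simp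
        moreover have "3/2 - 2 * t = (3/2) * (1 - 4 / (3 * sqrt (real d)))"
          by (simp add: t_def field_simps)
        moreover have "norm (axis b 1 - u j) powr z = (3/2 - 2 * t) powr (z / 2)"
          using that ne[OF that(2)] by (simp add: dist tilted_def)
        ultimately show ?thesis
          by (metis \<beta>_def a_def powr_mult)
      qed
      have coreset_cost: "(\<Sum>j<k. \<Sum>b\<in>A j. w (copies n j b) * norm (axis b 1 - u j) powr z)
          = \<beta> * (a * om L + om G)"
        unfolding split om_def distrib_left sum_distrib_left
        by (intro arg_cong2[of _ _ _ _ "(+)"] sum.cong refl) (simp_all add: ne u h_cost inA)
      have "\<beta> * (real (card L) * real d - (1 - a) * (2/5 * (real (card L) * real d))
            + real (card G) * real d)
          \<le> (\<Sum>j<k. \<Sum>b\<in>-{n}. norm (axis b 1 - u j) powr z)"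
      proof -
        \<comment> \<open>At most \<open>2/5 * d\<close> points of a light copy become cheaper, each
          by the factor \<open>a\<close>; the others still cost \<open>\<beta>\<close>.\<close>
        have "\<beta> * (real d - (1 - a) * (2/5 * real d)) \<le> (\<Sum>b\<in>-{n}. norm (axis b 1 - u j) powr z)"
          if j: "j \<in> L" for j
        proof -
          have c: "card (A j) \<le> d" using inner cardB by (metis card_mono finite)
          have "(\<Sum>b\<in>-{n}. norm (axis b 1 - u j) powr z)
              = (\<Sum>b\<in>-{n} - A j. norm (axis b 1 - u j) powr z) + (\<Sum>b\<in>A j. norm (axis b 1 - u j) powr z)"
            using inner by (intro sum.subset_diff) auto
          also have "(\<Sum>b\<in>-{n} - A j. norm (axis b 1 - u j) powr z) = (\<Sum>b\<in>-{n} - A j. \<beta>)"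
            using j by (intro sum.cong) (auto simp: out)
          also have "\<dots> = (real d - real (card (A j))) * \<beta>"
            using inner cardB nA c by (simp add: card_Diff_subset of_nat_diff)
          also have "(\<Sum>b\<in>A j. norm (axis b 1 - u j) powr z) = real (card (A j)) * (\<beta> * a)"
            using j by (simp add: inA)
          finally have "(\<Sum>b\<in>-{n}. norm (axis b 1 - u j) powr z)
              = \<beta> * (real d - (1 - a) * real (card (A j)))"
            by (simp add: algebra_simps)
          moreover have "(1 - a) * real (card (A j)) \<le> (1 - a) * (2/5 * real d)"
            using j x assms(3) by (intro mult_left_mono) (auto simp: L_def)
          ultimately show ?thesis using \<beta> by simp
        qed
        then have "real (card L) * (\<beta> * (real d - (1 - a) * (2/5 * real d)))
            \<le> (\<Sum>j\<in>L. \<Sum>b\<in>-{n}. norm (axis b 1 - u j) powr z)"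
          by (intro sum_bounded_below) auto
        moreover have "(\<Sum>j\<in>G. \<Sum>b\<in>-{n}. norm (axis b 1 - u j) powr z)
            = \<beta> * (real (card G) * real d)"
          using cardB by (simp add: u h_cost)
        ultimately show ?thesis unfolding split by (simp add: algebra_simps)
      qed
      then have "(1 - \<epsilon>) * (\<beta> * (real (card L) * real d - (1 - a) * (2/5 * (real (card L) * real d))
            + real (card G) * real d))
          \<le> (1 - \<epsilon>) * (\<Sum>j<k. \<Sum>b\<in>-{n}. norm (axis b 1 - u j) powr z)"
        using assms by (intro mult_left_mono) auto
      also note cost_le[of u, OF u5]
      also note coreset_cost
      finally show ?thesis by (simp add: cancel_left)
    qed

    have heavy: "3 * real (card G) < real (card L)"
    proof -
      \<comment> \<open>Each heavy copy holds at least \<open>2/5 * d\<close> of fewer than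
        \<open>d * k / 10\<close> coreset points, so fewer than \<open>k / 4\<close> copies are
        heavy.\<close>
      have "z ^ 4 \<ge> 1" using assms by simp
      then have "real d * real k / (10 * z ^ 4) \<le> real d * real k / 10"
        by (intro divide_left_mono) auto
      with small have "real (card S) < real d * real k / 10" by linarith
      moreover have "real (card S) = (\<Sum>j<k. real (card (A j)))"
        using sum_subset_copy_data[OF SP, of "\<lambda>_. 1::real"] by (simp add: A_def)
      moreover have "real (card G) * (2/5 * real d) \<le> (\<Sum>j\<in>G. real (card (A j)))"
        by (rule sum_bounded_below) (auto simp: G_def L_def)
      moreover have "(\<Sum>j\<in>L. real (card (A j))) \<ge> 0" by (simp add: sum_nonneg)
      ultimately have "real d * (4 * real (card G)) < real d * real k"
        by (simp add: split algebra_simps)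
      then have "4 * real (card G) < real k" using assms by simp
      moreover have "card L + card G = k"
        using LG by (metis card_Un_disjoint card_lessThan)
      ultimately show ?thesis by linarith
    qed

    have "\<epsilon> \<le> 1/10"
    proof -
      have "1 \<le> 1 / (100 * \<epsilon>\<^sup>2)" using assms by linarith
      then have "(10 * \<epsilon>)\<^sup>2 \<le> 1\<^sup>2" using assms by (simp add: field_simps)
      then have "10 * \<epsilon> \<le> 1" by (rule power2_le_imp_le) simp
      then show ?thesis by simp
    qed
    moreover have "r \<ge> 4"
    proof -
      have "(16::real) powr (1/2) \<le> 16 powr (z / 2)" using assms by (intro powr_mono) auto
      then show ?thesis by (simp add: r_def powr_half_sqrt)
    qed
    ultimately show False
      using light_copies_contradiction[OF _ _ _ _ heavy _ x total far tilt] assms by simp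
  qed
  then show ?thesis using finite_copy_data by blast
qed

end
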